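(* Let $M_P=(\Sigma,A,\tau,\rho_\alpha)$ be the CVaR-cost particle belief MDP with finite action set $A$, risk level $\alpha\in(0,1]$, discount $\gamma\in(0,1]$ and horizon $T\in\mathbb N$, and let $\hat V^*_{M_P,t}$ be the sparse-sampling estimator with $N_b\in\mathbb N$ sampled successor beliefs per action and node (all defined in the context). Let $\Delta\rho=c_{\max}-c_{\min}$ and $S_t=\frac{(T-t)(T-t+1)}{2}$. Then for every $t\in\{0,\dots,T\}$, every particle belief $\bar b_t\in\Sigma$, every $\delta\in(0,1)$ and every integer $N_b>1$, $$P\left(\left|V^*_{M_P,t}(\bar b_t,\alpha)-\hat V^*_{M_P,t}(\bar b_t,\alpha)\right|\le \Delta\rho\cdot S_t\sqrt{\frac{\ln\left(\frac{2|A|\left((|A|N_b)^{T-t}-1\right)}{\delta(|A|N_b-1)}\right)}{2N_b}}\right)\ge 1-\delta,$$ where the right-hand side of the inequality inside the probability is read as $0$ when $t=T$.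
   Context: Costs. $X$ is a state space, $A$ a finite action space with $|A|$ elements, and $c:X\times A\to\mathbb R$ a cost with $c_{\min}\le c(x,a)\le c_{\max}$ for all $x,a$. Weighted CVaR. For reals $y_1,\dots,y_n$ and weights $\tilde w_i\ge 0$ with $\sum_i\tilde w_i=1$, $\hat C_\alpha(\{y_i\},\{\tilde w_i\})=\inf_{w\in\mathbb R}\{w+\frac1\alpha\sum_{i=1}^n\tilde w_i(y_i-w)^+\}$, with $(y)^+=\max(y,0)$. Particle belief MDP (PB-MDP). Fix $N_p\in\mathbb N$. Its states are particle beliefs $\Sigma=\{\bar b=\{(x_i,w_i)\}_{i=1}^{N_p}: x_i\in X,\ w_i\ge0,\ \sum_i w_i>0\}$; its actions are $A$; $\tau(\bar b_{t+1}\mid\bar b_t,a)$ is its (Markov) transition kernel on $\Sigma$; its immediate cost is $\rho_\alpha(\bar b,a)=\hat C_\alpha(\{c(x_i,a)\}_{i=1}^{N_p},\{\tilde w_i\}_{i=1}^{N_p})$ with $\tilde w_i=w_i/\sum_j w_j$. Optimal value functions. $V^*_{M_P,T+1}=0$ and, for $t\le T$, $Q^*_{M_P,t}(\bar b_t,a,\alpha)=\rho_\alpha(\bar b_t,a)+\gamma\,\mathbb E[V^*_{M_P,t+1}(\bar b_{t+1},\alpha)\mid\bar b_t,a]$ with $\bar b_{t+1}\sim\tau(\cdot\mid\bar b_t,a)$, and $V^*_{M_P,t}(\bar b_t,\alpha)=\min_{a\in A}Q^*_{M_P,t}(\bar b_t,a,\alpha)$. Sparse-sampling estimator. $\hat V^*_{M_P,T+1}=0$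 and, for $t\le T$, $\hat Q^*_{M_P,t}(\bar b_t,a,\alpha)=\rho_\alpha(\bar b_t,a)+\frac{\gamma}{N_b}\sum_{i=1}^{N_b}\hat V^*_{M_P,t+1}(\bar b^{i}_{t+1},\alpha)$, $\hat V^*_{M_P,t}(\bar b_t,\alpha)=\min_{a\in A}\hat Q^*_{M_P,t}(\bar b_t,a,\alpha)$, where for each action $a$ the $N_b$ successors $\bar b^{i}_{t+1}$ are i.i.d. samples from $\tau(\cdot\mid\bar b_t,a)$, and the estimators at the sampled successors are built recursively in the same way with fresh independent samples. The probability is over this sampling. *)

theory Defs
  imports "HOL-Probability.Probability"
begin

section \<open>Weighted CVaR and particle beliefs\<close>

definition weighted_cvar :: "real \<Rightarrow> nat \<Rightarrow> (nat \<Rightarrow> real) \<Rightarrow> (nat \<Rightarrow> real) \<Rightarrow> real" where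
  "weighted_cvar \<alpha> n y w = (INF v. v + 1 / \<alpha> * (\<Sum>i<n. w i * max (y i - v) 0))"

type_synonym 'x belief = "nat \<Rightarrow> 'x \<times> real"

text \<open>The state space \<open>\<Sigma>\<close>: families of \<open>N\<^sub>p\<close> particle-weight pairs, indexed from 0, with the
  trace of the product sigma-algebra.\<close>

definition belief_space :: "'x measure \<Rightarrow> nat \<Rightarrow> 'x belief measure" where
  "belief_space X Np =
     restrict_space (Pi\<^sub>M {..<Np} (\<lambda>_. X \<Otimes>\<^sub>M borel))
       {b. (\<forall>i<Np. 0 \<le> snd (b i)) \<and> 0 < (\<Sum>i<Np. snd (b i))}"

definition belief_cost :: "nat \<Rightarrow> ('x \<Rightarrow> 'a \<Rightarrow> real) \<Rightarrow> real \<Rightarrow> 'x belief \<Rightarrow> 'a \<Rightarrow> real" where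
  "belief_cost Np c \<alpha> b a =
     weighted_cvar \<alpha> Np (\<lambda>i. c (fst (b i)) a) (\<lambda>i. snd (b i) / (\<Sum>j<Np. snd (b j)))"

section \<open>Optimal value functions\<close>

text \<open>For an arbitrary finite-horizon MDP with states of type \<open>'s\<close>, actions \<open>A\<close>, kernel \<open>\<tau>\<close> and
  immediate cost \<open>\<rho>\<close>.  The dependence of the value functions on \<open>\<alpha>\<close> is through \<open>\<rho>\<close>.\<close>

function V_opt :: "'a set \<Rightarrow> ('s \<Rightarrow> 'a \<Rightarrow> 's measure) \<Rightarrow> ('s \<Rightarrow> 'a \<Rightarrow> real) \<Rightarrow> real \<Rightarrow> nat
                    \<Rightarrow> nat \<Rightarrow> 's \<Rightarrow> real"
  and Q_opt :: "'a set \<Rightarrow> ('s \<Rightarrow> 'a \<Rightarrow> 's measure) \<Rightarrow> ('s \<Rightarrow> 'a \<Rightarrow> real) \<Rightarrow> real \<Rightarrow> nat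
                    \<Rightarrow> nat \<Rightarrow> 's \<Rightarrow> 'a \<Rightarrow> real"
  where
    "V_opt A \<tau> \<rho> \<gamma> T t b = (if T < t then 0 else Min ((\<lambda>a. Q_opt A \<tau> \<rho> \<gamma> T t b a) ` A))"
  | "Q_opt A \<tau> \<rho> \<gamma> T t b a = \<rho> b a + \<gamma> * (\<integral>b'. V_opt A \<tau> \<rho> \<gamma> T (Suc t) b' \<partial>(\<tau> b a))"
  by pat_completeness auto
termination
  by (relation "Wellfounded.measure (case_sum (\<lambda>(A, \<tau>, \<rho>, \<gamma>, T, t, b). 2 * (Suc T - t))
                                  (\<lambda>(A, \<tau>, \<rho>, \<gamma>, T, t, b, a). 2 * (T - t) + 1))") auto

declare V_opt.simps [simp del] Q_opt.simps [simp del]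

section \<open>Sparse sampling\<close>

text \<open>A node of the search tree is the path leading to it from the root \<open>[]\<close>: the node
  \<open>p @ [(a, i)]\<close> is the \<open>i\<close>-th sampled successor of \<open>p\<close> under action \<open>a\<close>.\<close>

type_synonym 'a node = "('a \<times> nat) list"

definition tree_level :: "'a set \<Rightarrow> nat \<Rightarrow> nat \<Rightarrow> 'a node set" where
  "tree_level A Nb k = {p. set p \<subseteq> A \<times> {..<Nb} \<and> length p = k}"

definition tree_nodes :: "'a set \<Rightarrow> nat \<Rightarrow> nat \<Rightarrow> 'a node set" where
  "tree_nodes A Nb k = {p. set p \<subseteq> A \<times> {..<Nb} \<and> length p \<le> k}"

text \<open>The joint law of the beliefs at all nodes of depth at most \<open>k\<close>, for the root belief \<open>b\<close>.
  Given the beliefs \<open>\<omega>\<close> down to depth \<open>k\<close>, the beliefs at depth \<open>k + 1\<close> are sampled independently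
  of each other, the one at \<open>p @ [(a, i)]\<close> from \<open>\<tau> (\<omega> p) a\<close>.\<close>

primrec sample_tree :: "'s measure \<Rightarrow> 'a set \<Rightarrow> ('s \<Rightarrow> 'a \<Rightarrow> 's measure) \<Rightarrow> nat \<Rightarrow> 's
                          \<Rightarrow> nat \<Rightarrow> ('a node \<Rightarrow> 's) measure" where
  "sample_tree S A \<tau> Nb b 0 =
     return (Pi\<^sub>M (tree_nodes A Nb 0) (\<lambda>_. S)) (\<lambda>p\<in>tree_nodes A Nb 0. b)"
| "sample_tree S A \<tau> Nb b (Suc k) =
     sample_tree S A \<tau> Nb b k \<bind> (\<lambda>\<omega>.
       distr (Pi\<^sub>M (tree_level A Nb (Suc k)) (\<lambda>p. \<tau> (\<omega> (butlast p)) (fst (last p))))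
             (Pi\<^sub>M (tree_nodes A Nb (Suc k)) (\<lambda>_. S))
             (\<lambda>\<omega>'. merge (tree_nodes A Nb k) (tree_level A Nb (Suc k)) (\<omega>, \<omega>')))"

text \<open>The estimators at node \<open>p\<close>, regarded as a node at time \<open>t\<close>, on the sampled tree \<open>\<omega>\<close>.\<close>

function V_hat :: "'a set \<Rightarrow> ('s \<Rightarrow> 'a \<Rightarrow> real) \<Rightarrow> real \<Rightarrow> nat \<Rightarrow> nat \<Rightarrow> ('a node \<Rightarrow> 's)
                    \<Rightarrow> nat \<Rightarrow> 'a node \<Rightarrow> real"
  and Q_hat :: "'a set \<Rightarrow> ('s \<Rightarrow> 'a \<Rightarrow> real) \<Rightarrow> real \<Rightarrow> nat \<Rightarrow> nat \<Rightarrow> ('a node \<Rightarrow> 's)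
                    \<Rightarrow> nat \<Rightarrow> 'a node \<Rightarrow> 'a \<Rightarrow> real"
  where
    "V_hat A \<rho> \<gamma> Nb T \<omega> t p = (if T < t then 0 else Min ((\<lambda>a. Q_hat A \<rho> \<gamma> Nb T \<omega> t p a) ` A))"
  | "Q_hat A \<rho> \<gamma> Nb T \<omega> t p a =
       \<rho> (\<omega> p) a + \<gamma> / real Nb * (\<Sum>i<Nb. V_hat A \<rho> \<gamma> Nb T \<omega> (Suc t) (p @ [(a, i)]))"
  by pat_completeness auto
termination
  by (relation "Wellfounded.measure (case_sum (\<lambda>(A, \<rho>, \<gamma>, Nb, T, \<omega>, t, p). 2 * (Suc T - t))
                                  (\<lambda>(A, \<rho>, \<gamma>, Nb, T, \<omega>, t, p, a). 2 * (T - t) + 1))") auto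

declare V_hat.simps [simp del] Q_hat.simps [simp del]

end

theory Submission
  imports Defs
begin

text \<open>At a node of depth \<open>d\<close> the optimal values one step later lie in an interval of length
  \<open>(cmax - cmin) * (T - t - d)\<close>, because \<open>\<gamma> \<le> 1\<close>.  Given the beliefs down to depth \<open>d\<close>, Hoeffding's
  inequality with deviation \<open>(cmax - cmin) * (T - t - d) * r\<close> therefore fails with probability at most
  \<open>2 * exp (- 2 * Nb * r^2)\<close>, which does not depend on \<open>d\<close>; a union bound over all node-action pairs of
  depth less than \<open>T - t\<close> fixes \<open>r\<close>.  When no deviation is exceeded, \<open>Min\<close> being nonexpansive, the
  errors accumulate along the levels to \<open>(cmax - cmin) * r * (1 + \<dots> + (T - t))\<close>.\<close>

subsection \<open>Weighted CVaR\<close>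

text \<open>Since the weights sum to 1, \<open>l - v\<close> is its own weighted mean and is
  dominated termwise by the positive parts; the factor \<open>1 / \<alpha>\<close>, which is at
  least 1, only enlarges that nonnegative sum. This makes the infimum defining
  \<open>weighted_cvar\<close> one over a set bounded below.\<close>

lemma weighted_cvar_objective_ge:
  fixes y w :: "nat \<Rightarrow> real"
  assumes "0 < \<alpha>" "\<alpha> \<le> 1"
    and w: "\<And>i. i < n \<Longrightarrow> 0 \<le> w i" "(\<Sum>i<n. w i) = 1"
    and y: "\<And>i. i < n \<Longrightarrow> l \<le> y i"
  shows "l \<le> v + 1 / \<alpha> * (\<Sum>i<n. w i * max (y i - v) 0)"
proof -
  have "l - v = (\<Sum>i<n. w i * (l - v))"
    using w(2) by (simp flip: sum_distrib_right)
  also have "\<dots> \<le> (\<Sum>i<n. w i * max (y i - v) 0)"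
    using w(1) y by (intro sum_mono mult_left_mono) (auto simp: max_def dest: y)
  also have "\<dots> \<le> 1 / \<alpha> * (\<Sum>i<n. w i * max (y i - v) 0)"
  proof -
    have "0 \<le> (\<Sum>i<n. w i * max (y i - v) 0)"
      using w(1) by (intro sum_nonneg) auto
    moreover have "1 \<le> 1 / \<alpha>"
      using assms(1,2) by simp
    ultimately show ?thesis
      using mult_right_mono by fastforce
  qed
  finally show ?thesis by simp
qed

text \<open>The lower bound holds for every value of the objective. For the upper bound the
  objective is evaluated at \<open>v = u\<close>, where every excess over \<open>v\<close>
  vanishes.\<close>

lemma weighted_cvar_bounds:
  assumes "0 < \<alpha>" "\<alpha> \<le> 1"
    and w: "\<And>i. i < n \<Longrightarrow> 0 \<le> w i" "(\<Sum>i<n. w i) = 1"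
    and y: "\<And>i. i < n \<Longrightarrow> l \<le> y i" "\<And>i. i < n \<Longrightarrow> y i \<le> u"
  shows "l \<le> weighted_cvar \<alpha> n y w" "weighted_cvar \<alpha> n y w \<le> u"
proof -
  note ge = weighted_cvar_objective_ge[of \<alpha> n w l y, OF assms(1-5)]
  show "l \<le> weighted_cvar \<alpha> n y w"
    unfolding weighted_cvar_def by (intro cINF_greatest ge) auto
  have "(\<Sum>i<n. w i * max (y i - u) 0) = 0"
    using y(2) by (intro sum.neutral) (auto simp: max_def intro: antisym)
  then have "weighted_cvar \<alpha> n y w \<le> u + 1 / \<alpha> * 0"
    unfolding weighted_cvar_def
    by (intro cINF_lower2[where x=u] bdd_belowI2[where m=l] ge) auto
  then show "weighted_cvar \<alpha> n y w \<le> u"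
    by simp
qed

text \<open>The set where \<open>f\<close> is at least its rational infimum is closed and contains
  the dense set of rationals, hence is the whole line. It turns the CVaR infimum into a countable
  one, which preserves measurability.\<close>

lemma INF_continuous_eq_INF_rationals:
  fixes f :: "real \<Rightarrow> real"
  assumes "continuous_on UNIV f" "bdd_below (range f)"
  shows "(INF v. f v) = (INF v\<in>\<rat>. f v)"
proof (rule antisym)
  show "(INF v. f v) \<le> (INF v\<in>\<rat>. f v)"
    using assms by (intro cINF_superset_mono) (auto intro: Rats_0)
  have "closed {v. (INF q\<in>\<rat>. f q) \<le> f v}"
    by (intro closed_Collect_le continuous_intros assms)
  moreover have "\<rat> \<subseteq> {v. (INF q\<in>\<rat>. f q) \<le> f v}"
    using bdd_below_mono[OF assms(2) image_mono[OF subset_UNIV]] by (auto intro!: cINF_lower)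
  ultimately have "closure \<rat> \<subseteq> {v. (INF q\<in>\<rat>. f q) \<le> f v}"
    by (rule closure_minimal[rotated])
  then show "(INF v\<in>\<rat>. f v) \<le> (INF v. f v)"
    unfolding Rats_closure_real by (intro cINF_greatest) auto
qed

lemma borel_measurable_weighted_cvar:
  assumes "0 < \<alpha>" "\<alpha> \<le> 1"
    and [measurable]: "\<And>i. i < n \<Longrightarrow> (\<lambda>x. y x i) \<in> borel_measurable M"
      "\<And>i. i < n \<Longrightarrow> (\<lambda>x. w x i) \<in> borel_measurable M"
    and w: "\<And>x i. x \<in> space M \<Longrightarrow> i < n \<Longrightarrow> 0 \<le> w x i"
      "\<And>x. x \<in> space M \<Longrightarrow> (\<Sum>i<n. w x i) = 1"
    and y: "\<And>x i. x \<in> space M \<Longrightarrow> i < n \<Longrightarrow> l \<le> y x i"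
  shows "(\<lambda>x. weighted_cvar \<alpha> n (y x) (w x)) \<in> borel_measurable M"
proof -
  have "(\<lambda>x. INF v\<in>\<rat>. v + 1 / \<alpha> * (\<Sum>i<n. w x i * max (y x i - v) 0)) \<in> borel_measurable M"
    by (intro borel_measurable_cINF_real countable_rat) measurable
  moreover have "weighted_cvar \<alpha> n (y x) (w x)
      = (INF v\<in>\<rat>. v + 1 / \<alpha> * (\<Sum>i<n. w x i * max (y x i - v) 0))" if "x \<in> space M" for x
    unfolding weighted_cvar_def using assms(1,2) w[OF that] y[OF that]
    by (intro INF_continuous_eq_INF_rationals bdd_belowI2[where m=l] weighted_cvar_objective_ge)
       (auto intro!: continuous_intros)
  ultimately show ?thesis
    by (subst measurable_cong) auto
qed

section \<open>Cost of a particle belief\<close>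

lemma space_belief_spaceD:
  assumes "b \<in> space (belief_space X Np)"
  shows "\<And>i. i < Np \<Longrightarrow> fst (b i) \<in> space X"
    and "\<And>i. i < Np \<Longrightarrow> 0 \<le> snd (b i)"
    and "0 < (\<Sum>i<Np. snd (b i))"
  using assms
  by (auto simp: belief_space_def space_restrict_space space_PiM space_pair_measure PiE_iff
      mem_Times_iff)

lemma normalized_weights:
  assumes "b \<in> space (belief_space X Np)"
  shows "\<And>i. i < Np \<Longrightarrow> 0 \<le> snd (b i) / (\<Sum>j<Np. snd (b j))"
    and "(\<Sum>i<Np. snd (b i) / (\<Sum>j<Np. snd (b j))) = 1"
  using space_belief_spaceD[OF assms] by (auto simp flip: sum_divide_distrib)

lemma belief_cost_bounds:
  assumes "0 < \<alpha>" "\<alpha> \<le> 1" "b \<in> space (belief_space X Np)"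
    and "\<And>x. x \<in> space X \<Longrightarrow> l \<le> c x a \<and> c x a \<le> u"
  shows "l \<le> belief_cost Np c \<alpha> b a" "belief_cost Np c \<alpha> b a \<le> u"
  unfolding belief_cost_def using assms space_belief_spaceD(1)[OF assms(3)] normalized_weights[OF assms(3)]
  by (auto intro!: weighted_cvar_bounds)

lemma borel_measurable_belief_cost:
  assumes "0 < \<alpha>" "\<alpha> \<le> 1"
    and c[measurable]: "(\<lambda>x. c x a) \<in> borel_measurable X"
    and "\<And>x. x \<in> space X \<Longrightarrow> l \<le> c x a"
  shows "(\<lambda>b. belief_cost Np c \<alpha> b a) \<in> borel_measurable (belief_space X Np)"
proof -
  have [measurable]: "(\<lambda>b. c (fst (b i)) a) \<in> borel_measurable (belief_space X Np)"
      "(\<lambda>b. snd (b i)) \<in> borel_measurable (belief_space X Np)" if "i < Np" for i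
    using that unfolding belief_space_def by (auto intro!: measurable_restrict_space1)
  show ?thesis
    unfolding belief_cost_def
    by (rule borel_measurable_weighted_cvar[where l=l])
       (use assms in \<open>auto simp: normalized_weights dest: space_belief_spaceD(1)\<close>)
qed

subsection \<open>Finite products of kernels\<close>

text \<open>Measurability of a kernel need only be tested on an intersection-stable generator. On a
  rectangle the product measure is a finite product of the measurable functions
  \<open>emeasure (K i x) (E i)\<close>.\<close>

lemma measurable_PiM_prob_algebra:
  assumes I: "finite I" and K: "\<And>i. i \<in> I \<Longrightarrow> K i \<in> M \<rightarrow>\<^sub>M prob_algebra (N i)"
  shows "(\<lambda>x. \<Pi>\<^sub>M i\<in>I. K i x) \<in> M \<rightarrow>\<^sub>M prob_algebra (Pi\<^sub>M I N)"
proof (rule measurable_prob_algebra_generated[OF sets_PiM Int_stable_prod_algebra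
      prod_algebra_sets_into_space])
  have KD: "prob_space (K i x)" "sets (K i x) = sets (N i)" if "i \<in> I" "x \<in> space M" for i x
    using measurable_space[OF K that(2)] that by (auto simp: space_prob_algebra)
  show "prob_space (\<Pi>\<^sub>M i\<in>I. K i x)" if "x \<in> space M" for x
    using that by (intro prob_space_PiM KD)
  show "sets (\<Pi>\<^sub>M i\<in>I. K i x) = sets (Pi\<^sub>M I N)" if "x \<in> space M" for x
    using that by (intro sets_PiM_cong KD) auto
  fix B assume "B \<in> prod_algebra I N"
  then obtain E where B: "B = Pi\<^sub>E I E" and E: "\<And>i. i \<in> I \<Longrightarrow> E i \<in> sets (N i)"
    unfolding prod_algebra_eq_finite[OF I] by auto
  have "emeasure (\<Pi>\<^sub>M i\<in>I. K i x) B = (\<Prod>i\<in>I. emeasure (K i x) (E i))" if x: "x \<in> space M" for x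
  proof -
    \<comment> \<open>Over the full index set the cylinder of a rectangle is the rectangle itself,
      because each side lies in the space of its factor.\<close>
    have "prod_emb I (\<lambda>i. K i x) I (Pi\<^sub>E I E) = B"
      unfolding B using E KD x by (intro prod_emb_PiE_same_index) (metis sets.sets_into_space)
    then show ?thesis
      using emeasure_PiM_emb[of I "\<lambda>i. K i x" I E] I E KD x by simp
  qed
  moreover have "(\<lambda>x. \<Prod>i\<in>I. emeasure (K i x) (E i)) \<in> borel_measurable M"
    using K E by (intro borel_measurable_prod_ennreal measurable_emeasure_kernel measurable_prob_algebraD)
  ultimately show "(\<lambda>x. emeasure (\<Pi>\<^sub>M i\<in>I. K i x) B) \<in> borel_measurable M"
    by (subst measurable_cong) auto
qed

text \<open>Distinct coordinates of a product measure are independent, and those with the same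
  factor \<open>N\<close> are identically distributed. The map \<open>f\<close> selects such
  coordinates: later the product runs over a whole tree level, while a sample mean reads only the
  children of one node under one action.\<close>

lemma Hoeffding_ineq_PiM_components:
  fixes g :: "'s \<Rightarrow> real"
  assumes M: "\<And>i. i \<in> I \<Longrightarrow> prob_space (M i)"
    and f: "inj_on f {..<n}" "\<And>i. i < n \<Longrightarrow> f i \<in> I" "\<And>i. i < n \<Longrightarrow> M (f i) = N"
    and "0 < n"
    and [measurable]: "g \<in> borel_measurable N"
    and g: "\<And>x. x \<in> space N \<Longrightarrow> l \<le> g x \<and> g x \<le> l + w"
    and "0 < w" "0 \<le> \<epsilon>"
  shows "measure (Pi\<^sub>M I M) {x \<in> space (Pi\<^sub>M I M). \<epsilon> \<le> \<bar>(\<Sum>i<n. g (x (f i))) / real n - (\<integral>y. g y \<partial>N)\<bar>}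
    \<le> 2 * exp (- (2 * real n * \<epsilon>\<^sup>2 / w\<^sup>2))"
proof -
  interpret P: prob_space "Pi\<^sub>M I M"
    by (intro prob_space_PiM M)
  have comp: "(\<lambda>x. x (f i)) \<in> Pi\<^sub>M I M \<rightarrow>\<^sub>M N" if "i < n" for i
    using measurable_component_singleton[OF f(2)[OF that], of M] f(3)[OF that] by simp
  have distr_comp: "distr (Pi\<^sub>M I M) N (\<lambda>x. x (f i)) = N" if "i < n" for i
    using distr_PiM_component[of I M, OF M f(2)[OF that]] unfolding f(3)[OF that] .
  \<comment> \<open>Independence means that the joint law of the selected coordinates is the product
    of their laws; reindexing the product along the injective \<open>f\<close> gives this.\<close>
  have "P.indep_vars (\<lambda>_. N) (\<lambda>i x. x (f i)) {..<n}"
  proof (subst P.indep_vars_iff_distr_eq_PiM')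
    have "(\<Pi>\<^sub>M i\<in>{..<n}. M (f i)) = (\<Pi>\<^sub>M i\<in>{..<n}. N)"
      by (intro PiM_cong) (simp_all add: f(3))
    moreover have "distr (Pi\<^sub>M I M) (\<Pi>\<^sub>M i\<in>{..<n}. M (f i)) (\<lambda>x. \<lambda>i\<in>{..<n}. x (f i))
        = (\<Pi>\<^sub>M i\<in>{..<n}. M (f i))"
      using f(1,2) by (intro distr_PiM_reindex M) auto
    moreover have "(\<Pi>\<^sub>M i\<in>{..<n}. distr (Pi\<^sub>M I M) N (\<lambda>x. x (f i))) = (\<Pi>\<^sub>M i\<in>{..<n}. N)"
      by (intro PiM_cong) (simp_all add: distr_comp)
    ultimately show "distr (Pi\<^sub>M I M) (\<Pi>\<^sub>M i\<in>{..<n}. N) (\<lambda>x. \<lambda>i\<in>{..<n}. x (f i))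
        = (\<Pi>\<^sub>M i\<in>{..<n}. distr (Pi\<^sub>M I M) N (\<lambda>x. x (f i)))"
      by (simp only:)
    show "{..<n} \<noteq> {}"
      using \<open>0 < n\<close> by auto
  qed (use comp in simp)
  then have indep: "P.indep_vars (\<lambda>_. borel) (\<lambda>i x. g (x (f i))) {..<n}"
    by (rule P.indep_vars_compose2) auto
  have meas: "(\<lambda>x. g (x (f i))) \<in> borel_measurable (Pi\<^sub>M I M)" if "i < n" for i
    by (rule measurable_compose[OF comp[OF that]]) measurable
  have distr_g: "distr (Pi\<^sub>M I M) borel (\<lambda>x. g (x (f i))) = distr N borel g" if "i < n" for i
    using distr_distr[of g N borel "\<lambda>x. x (f i)" "Pi\<^sub>M I M"] comp[OF that] distr_comp[OF that]
    by (simp add: comp_def)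
  \<comment> \<open>Coordinate \<open>f 0\<close>, available because \<open>0 < n\<close>,
    represents the common law.\<close>
  interpret H: Hoeffding_ineq_iid "Pi\<^sub>M I M" "{..<n}" "\<lambda>i x. g (x (f i))" "\<lambda>x. g (x (f 0))"
      l "l + w" "P.expectation (\<lambda>x. g (x (f 0)))"
  proof unfold_locales
    show "AE x in Pi\<^sub>M I M. g (x (f 0)) \<in> {l..l + w}"
      using measurable_space[OF comp[OF \<open>0 < n\<close>]] g by (intro AE_I2) auto
    show "P.indep_vars (\<lambda>_. borel) (\<lambda>i x. g (x (f i))) {..<n}"
      by (fact indep)
    show "distr (Pi\<^sub>M I M) borel (\<lambda>x. g (x (f i))) = distr (Pi\<^sub>M I M) borel (\<lambda>x. g (x (f 0)))"
      if "i \<in> {..<n}" for i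
      using that \<open>0 < n\<close> by (simp only: distr_g lessThan_iff)
    show "(\<lambda>x. g (x (f 0))) \<in> borel_measurable (Pi\<^sub>M I M)"
      using \<open>0 < n\<close> by (rule meas)
  qed simp_all
  have "P.expectation (\<lambda>x. g (x (f 0))) = (\<integral>y. g y \<partial>N)"
    using integral_distr[OF comp[OF \<open>0 < n\<close>], of g] unfolding distr_comp[OF \<open>0 < n\<close>] by simp
  moreover have "{..<n} \<noteq> {}" "l < l + w"
    using \<open>0 < n\<close> \<open>0 < w\<close> by auto
  ultimately show ?thesis
    using H.Hoeffding_ineq_abs_ge'[OF \<open>0 \<le> \<epsilon>\<close>] by simp
qed

subsection \<open>Optimal and estimated values\<close>

text \<open>A minimizer of \<open>g\<close> is a competitor in the minimum of \<open>f\<close>,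
  which bounds one difference; exchanging the two functions bounds the other.\<close>

lemma abs_Min_diff_le:
  fixes f g :: "'a \<Rightarrow> real"
  assumes "finite A" "A \<noteq> {}" "\<And>a. a \<in> A \<Longrightarrow> \<bar>f a - g a\<bar> \<le> e"
  shows "\<bar>Min (f ` A) - Min (g ` A)\<bar> \<le> e"
proof -
  have le: "Min (f ` A) \<le> Min (g ` A) + e"
    if "\<And>a. a \<in> A \<Longrightarrow> f a \<le> g a + e" for f g :: "'a \<Rightarrow> real"
  proof -
    have "Min (g ` A) \<in> g ` A"
      using assms(1,2) by (intro Min_in) auto
    then obtain a where "a \<in> A" "Min (g ` A) = g a"
      by blast
    then show ?thesis
      using that[of a] order_trans[OF Min_le[of "f ` A" "f a"]] assms(1) by simp
  qed
  show ?thesis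
    using le[of f g] le[of g f] assms(3) by (force simp: abs_le_iff)
qed

lemma (in prob_space) integral_in_interval:
  fixes f :: "'a \<Rightarrow> real"
  assumes [measurable]: "f \<in> borel_measurable M"
    and f: "\<And>x. x \<in> space M \<Longrightarrow> l \<le> f x \<and> f x \<le> u"
  shows "l \<le> (\<integral>x. f x \<partial>M)" "(\<integral>x. f x \<partial>M) \<le> u"
proof -
  have "integrable M f"
    using f by (intro integrable_const_bound[where B="max \<bar>l\<bar> \<bar>u\<bar>"] AE_I2) force+
  then show "l \<le> (\<integral>x. f x \<partial>M)" "(\<integral>x. f x \<partial>M) \<le> u"
    using f by (auto intro!: integral_ge_const integral_le_const)
qed

section \<open>Combinatorics of the search tree\<close>

lemma finite_tree_level: "finite A \<Longrightarrow> finite (tree_level A Nb k)"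
  unfolding tree_level_def by (intro finite_lists_length_eq) auto

lemma card_tree_level: "finite A \<Longrightarrow> card (tree_level A Nb k) = (card A * Nb) ^ k"
  unfolding tree_level_def by (subst card_lists_length_eq) (auto simp: card_cartesian_product)

lemma tree_level_subset_nodes: "j \<le> k \<Longrightarrow> tree_level A Nb j \<subseteq> tree_nodes A Nb k"
  by (auto simp: tree_level_def tree_nodes_def)

lemma tree_nodes_Suc: "tree_nodes A Nb (Suc k) = tree_nodes A Nb k \<union> tree_level A Nb (Suc k)"
  by (auto simp: tree_level_def tree_nodes_def)

lemma tree_level_child:
  "p \<in> tree_level A Nb k \<Longrightarrow> a \<in> A \<Longrightarrow> i < Nb \<Longrightarrow> p @ [(a, i)] \<in> tree_level A Nb (Suc k)"
  by (auto simp: tree_level_def)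

lemma tree_level_Suc_parent:
  assumes "q \<in> tree_level A Nb (Suc k)"
  shows "butlast q \<in> tree_level A Nb k" "fst (last q) \<in> A"
proof -
  obtain p x where "q = p @ [x]"
    using assms by (cases q rule: rev_cases) (auto simp: tree_level_def)
  then show "butlast q \<in> tree_level A Nb k" "fst (last q) \<in> A"
    using assms by (auto simp: tree_level_def)
qed

lemma root_in_tree_level: "[] \<in> tree_level A Nb 0"
  by (simp add: tree_level_def)

text \<open>The error analysis is carried out for an abstract MDP with measurable kernel and bounded
  measurable cost; \<open>hi - lo\<close> plays the part of the cost range. Horizon and time stay
  outside the locale because the inductions vary the time.\<close>

locale sampled_mdp =
  fixes S :: "'s measure" and A :: "'a set" and \<tau> :: "'s \<Rightarrow> 'a \<Rightarrow> 's measure"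
    and \<rho> :: "'s \<Rightarrow> 'a \<Rightarrow> real" and \<gamma> lo hi :: real and Nb :: nat
  assumes finite_A: "finite A" and A_nonempty: "A \<noteq> {}"
    and kernel: "\<And>a. a \<in> A \<Longrightarrow> (\<lambda>b. \<tau> b a) \<in> S \<rightarrow>\<^sub>M prob_algebra S"
    and cost_measurable: "\<And>a. a \<in> A \<Longrightarrow> (\<lambda>b. \<rho> b a) \<in> borel_measurable S"
    and cost_bounds: "\<And>b a. b \<in> space S \<Longrightarrow> a \<in> A \<Longrightarrow> lo \<le> \<rho> b a \<and> \<rho> b a \<le> hi"
    and lo_le_hi: "lo \<le> hi"
    and \<gamma>_pos: "0 < \<gamma>" and \<gamma>_le_1: "\<gamma> \<le> 1"
    and Nb_pos: "0 < Nb"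
begin

lemma kernelD:
  assumes "b \<in> space S" "a \<in> A"
  shows "prob_space (\<tau> b a)" "sets (\<tau> b a) = sets S" "space (\<tau> b a) = space S"
  using measurable_space[OF kernel[OF assms(2)] assms(1)]
  by (auto simp: space_prob_algebra dest: sets_eq_imp_space_eq)

lemma borel_measurable_kernel_integral:
  fixes f :: "'s \<Rightarrow> real"
  assumes "f \<in> borel_measurable S" "a \<in> A"
  shows "(\<lambda>b. \<integral>b'. f b' \<partial>\<tau> b a) \<in> borel_measurable S"
  using measurable_compose[OF measurable_prob_algebraD[OF kernel[OF assms(2)]]
      integral_measurable_subprob_algebra[OF assms(1)]] .

lemma borel_measurable_V_opt: "V_opt A \<tau> \<rho> \<gamma> T t \<in> borel_measurable S"
proof (induction "Suc T - t" arbitrary: t)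
  case 0
  then show ?case
    by (simp add: V_opt.simps)
next
  case (Suc m)
  from Suc(2) have "V_opt A \<tau> \<rho> \<gamma> T (Suc t) \<in> borel_measurable S"
    by (intro Suc(1)) auto
  then have "(\<lambda>b. Q_opt A \<tau> \<rho> \<gamma> T t b a) \<in> borel_measurable S" if "a \<in> A" for a
    using that unfolding Q_opt.simps
    by (intro borel_measurable_add borel_measurable_times borel_measurable_const
        cost_measurable borel_measurable_kernel_integral)
  with Suc(2) show ?case
    using borel_measurable_Min[OF finite_A, of "\<lambda>a b. Q_opt A \<tau> \<rho> \<gamma> T t b a" S]
    unfolding V_opt.simps[abs_def] by (cases "T < t") auto
qed

text \<open>Hoeffding's inequality depends only on the width of the interval, so its lower end is
  left existential. The width counts the costs still to be paid, \<open>Suc T - t\<close>, and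
  truncated subtraction makes it 0 beyond the horizon.\<close>

lemma V_opt_range:
  "\<exists>l. \<forall>b\<in>space S. l \<le> V_opt A \<tau> \<rho> \<gamma> T t b \<and> V_opt A \<tau> \<rho> \<gamma> T t b \<le> l + (hi - lo) * real (Suc T - t)"
proof (induction "Suc T - t" arbitrary: t)
  case 0
  then show ?case
    by (auto simp: V_opt.simps intro!: exI[of _ 0])
next
  case (Suc m)
  then have m: "m = Suc T - Suc t" and t: "\<not> T < t"
    by auto
  from Suc(1)[OF m] obtain l where l: "\<And>b. b \<in> space S \<Longrightarrow>
      l \<le> V_opt A \<tau> \<rho> \<gamma> T (Suc t) b \<and> V_opt A \<tau> \<rho> \<gamma> T (Suc t) b \<le> l + (hi - lo) * real m"
    using m by auto
  \<comment> \<open>The new lower end is the least cost plus the discounted old lower end. The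
    present cost adds \<open>hi - lo\<close> to the width, and discounting by
    \<open>\<gamma> \<le> 1\<close> does not enlarge the rest.\<close>
  have "lo + \<gamma> * l \<le> V_opt A \<tau> \<rho> \<gamma> T t b \<and> V_opt A \<tau> \<rho> \<gamma> T t b \<le> lo + \<gamma> * l + (hi - lo) * real (Suc m)"
    if b: "b \<in> space S" for b
  proof -
    have Q: "lo + \<gamma> * l \<le> Q_opt A \<tau> \<rho> \<gamma> T t b a"
        "Q_opt A \<tau> \<rho> \<gamma> T t b a \<le> lo + \<gamma> * l + (hi - lo) * real (Suc m)" if a: "a \<in> A" for a
    proof -
      interpret prob_space "\<tau> b a"
        using a b by (intro kernelD)
      let ?E = "\<integral>b'. V_opt A \<tau> \<rho> \<gamma> T (Suc t) b' \<partial>\<tau> b a"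
      have meas: "V_opt A \<tau> \<rho> \<gamma> T (Suc t) \<in> borel_measurable (\<tau> b a)"
        using borel_measurable_V_opt measurable_cong_sets[OF kernelD(2)[OF b a] refl] by blast
      have E: "l \<le> ?E" "?E \<le> l + (hi - lo) * real m"
        by (rule integral_in_interval[OF meas], use l kernelD(3)[OF b a] in auto)+
      have "\<gamma> * l \<le> \<gamma> * ?E" "\<gamma> * ?E \<le> \<gamma> * (l + (hi - lo) * real m)"
        using E \<gamma>_pos by (auto intro!: mult_left_mono)
      moreover have "\<gamma> * ((hi - lo) * real m) \<le> (hi - lo) * real m"
        using \<gamma>_pos \<gamma>_le_1 lo_le_hi by (intro mult_left_le_one_le) auto
      ultimately show "lo + \<gamma> * l \<le> Q_opt A \<tau> \<rho> \<gamma> T t b a"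
          "Q_opt A \<tau> \<rho> \<gamma> T t b a \<le> lo + \<gamma> * l + (hi - lo) * real (Suc m)"
        using cost_bounds[OF b a] unfolding Q_opt.simps by (auto simp: algebra_simps)
    qed
    have "Min ((\<lambda>a. Q_opt A \<tau> \<rho> \<gamma> T t b a) ` A) \<in> (\<lambda>a. Q_opt A \<tau> \<rho> \<gamma> T t b a) ` A"
      using finite_A A_nonempty by (intro Min_in) auto
    then obtain a where "a \<in> A" "V_opt A \<tau> \<rho> \<gamma> T t b = Q_opt A \<tau> \<rho> \<gamma> T t b a"
      using t by (auto simp: V_opt.simps[of _ _ _ _ _ t])
    with Q show ?thesis
      by simp
  qed
  then show ?case
    unfolding Suc(2)[symmetric] by blast
qed

text \<open>The length condition ensures that every belief read by the estimator sits at a node of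
  the tree of depth \<open>n\<close>, where evaluation is a measurable coordinate
  projection.\<close>

lemma borel_measurable_V_hat:
  assumes "set p \<subseteq> A \<times> {..<Nb}" "length p + (T - t) \<le> n"
  shows "(\<lambda>\<omega>. V_hat A \<rho> \<gamma> Nb T \<omega> t p) \<in> borel_measurable (\<Pi>\<^sub>M p\<in>tree_nodes A Nb n. S)"
  using assms
proof (induction "Suc T - t" arbitrary: t p)
  case 0
  then show ?case
    by (simp add: V_hat.simps)
next
  case (Suc m)
  let ?M = "\<Pi>\<^sub>M p\<in>tree_nodes A Nb n. S"
  have "(\<lambda>\<omega>. Q_hat A \<rho> \<gamma> Nb T \<omega> t p a) \<in> borel_measurable ?M" if a: "a \<in> A" for a
  proof -
    have p: "p \<in> tree_nodes A Nb n"
      using Suc.prems by (auto simp: tree_nodes_def)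
    have "(\<lambda>\<omega>. \<rho> (\<omega> p) a) \<in> borel_measurable ?M"
      by (rule measurable_compose[OF measurable_component_singleton[OF p] cost_measurable[OF a]])
    moreover have "(\<lambda>\<omega>. V_hat A \<rho> \<gamma> Nb T \<omega> (Suc t) (p @ [(a, i)])) \<in> borel_measurable ?M"
      if i: "i < Nb" for i
    proof (cases "t = T")
      \<comment> \<open>At \<open>t = T\<close> the child may lie below depth \<open>n\<close>, so
        the induction hypothesis could fail to apply; its estimate is the constant 0.\<close>
      case True
      then show ?thesis by (simp add: V_hat.simps)
    next
      case False
      with Suc a i show ?thesis
        by (intro Suc(1)) auto
    qed
    ultimately show ?thesis
      unfolding Q_hat.simps
      by (intro borel_measurable_add borel_measurable_times borel_measurable_const
          borel_measurable_sum) auto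
  qed
  with Suc(2) show ?case
    using borel_measurable_Min[OF finite_A, of "\<lambda>a \<omega>. Q_hat A \<rho> \<gamma> Nb T \<omega> t p a" ?M]
    unfolding V_hat.simps[of _ _ _ _ _ _ t] by (cases "T < t") auto
qed

subsection \<open>The law of the sampled tree\<close>

abbreviation trees :: "nat \<Rightarrow> ('a node \<Rightarrow> 's) measure" where
  "trees k \<equiv> \<Pi>\<^sub>M p\<in>tree_nodes A Nb k. S"

text \<open>Conditional law of the beliefs at depth \<open>Suc k\<close> given the tree
  \<open>\<omega>\<close> of depth \<open>k\<close>, as it occurs inside
  \<open>sample_tree\<close>.\<close>

abbreviation children :: "nat \<Rightarrow> ('a node \<Rightarrow> 's) \<Rightarrow> ('a node \<Rightarrow> 's) measure" where
  "children k \<omega> \<equiv> \<Pi>\<^sub>M p\<in>tree_level A Nb (Suc k). \<tau> (\<omega> (butlast p)) (fst (last p))"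

abbreviation extend :: "nat \<Rightarrow> ('a node \<Rightarrow> 's) \<Rightarrow> ('a node \<Rightarrow> 's) \<Rightarrow> 'a node \<Rightarrow> 's" where
  "extend k \<omega> \<omega>' \<equiv> merge (tree_nodes A Nb k) (tree_level A Nb (Suc k)) (\<omega>, \<omega>')"

lemma measurable_children:
  "children k \<in> trees k \<rightarrow>\<^sub>M prob_algebra (\<Pi>\<^sub>M p\<in>tree_level A Nb (Suc k). S)"
proof (rule measurable_PiM_prob_algebra)
  fix p assume "p \<in> tree_level A Nb (Suc k)"
  then have p: "butlast p \<in> tree_nodes A Nb k" "fst (last p) \<in> A"
    using tree_level_Suc_parent tree_level_subset_nodes[of k k] by blast+
  show "(\<lambda>\<omega>. \<tau> (\<omega> (butlast p)) (fst (last p))) \<in> trees k \<rightarrow>\<^sub>M prob_algebra S"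
    by (rule measurable_compose[OF measurable_component_singleton[OF p(1)] kernel[OF p(2)]])
qed (simp add: finite_tree_level finite_A)

lemma measurable_extend:
  "(\<lambda>(\<omega>, \<omega>'). extend k \<omega> \<omega>') \<in> trees k \<Otimes>\<^sub>M (\<Pi>\<^sub>M p\<in>tree_level A Nb (Suc k). S) \<rightarrow>\<^sub>M trees (Suc k)"
  using measurable_merge[of "tree_nodes A Nb k" "tree_level A Nb (Suc k)" "\<lambda>_. S"]
  by (simp add: tree_nodes_Suc)

text \<open>This makes each stage of \<open>sample_tree\<close> a bind along a probability kernel,
  so that the total mass stays 1 and probabilities can be computed by conditioning on the earlier
  levels.\<close>

lemma measurable_step:
  "(\<lambda>\<omega>. distr (children k \<omega>) (trees (Suc k)) (extend k \<omega>)) \<in> trees k \<rightarrow>\<^sub>M prob_algebra (trees (Suc k))"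
  by (rule measurable_distr_prob_space2[OF measurable_children measurable_extend])

lemma sample_tree_in_prob_algebra:
  assumes "b \<in> space S"
  shows "sample_tree S A \<tau> Nb b k \<in> space (prob_algebra (trees k))"
proof (induction k)
  case 0
  have "(\<lambda>p\<in>tree_nodes A Nb 0. b) \<in> space (trees 0)"
    using assms by (auto simp: space_PiM)
  then show ?case
    by (auto simp: space_prob_algebra intro!: prob_space_return)
next
  case (Suc k)
  show ?case
    using prob_space_bind'[OF Suc measurable_step] sets_bind'[OF Suc measurable_step]
    by (simp add: space_prob_algebra)
qed

lemma sample_treeD:
  assumes "b \<in> space S"
  shows prob_space_sample_tree: "prob_space (sample_tree S A \<tau> Nb b k)"
    and sets_sample_tree: "sets (sample_tree S A \<tau> Nb b k) = sets (trees k)"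
    and space_sample_tree: "space (sample_tree S A \<tau> Nb b k) = space (trees k)"
proof -
  show "prob_space (sample_tree S A \<tau> Nb b k)" and *: "sets (sample_tree S A \<tau> Nb b k) = sets (trees k)"
    using sample_tree_in_prob_algebra[OF assms, of k] unfolding space_prob_algebra by blast+
  show "space (sample_tree S A \<tau> Nb b k) = space (trees k)"
    by (rule sets_eq_imp_space_eq[OF *])
qed

subsection \<open>Deviations of the sample means\<close>

text \<open>The inequality is strict so that its negation is the closed bound wanted in the error
  estimate and so that a constant \<open>f\<close> with tolerance 0 never deviates.\<close>

definition deviates :: "('s \<Rightarrow> real) \<Rightarrow> real \<Rightarrow> ('a node \<Rightarrow> 's) \<Rightarrow> 'a node \<Rightarrow> 'a \<Rightarrow> bool" where
  "deviates f \<epsilon> \<omega> p a \<longleftrightarrow>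
     \<epsilon> < \<bar>(\<Sum>i<Nb. f (\<omega> (p @ [(a, i)]))) / real Nb - (\<integral>b. f b \<partial>\<tau> (\<omega> p) a)\<bar>"

text \<open>The index \<open>d\<close> is the depth of the parent; \<open>f d\<close> is evaluated
  at its children, one level deeper.\<close>

definition bad_level :: "(nat \<Rightarrow> 's \<Rightarrow> real) \<Rightarrow> (nat \<Rightarrow> real) \<Rightarrow> nat \<Rightarrow> ('a node \<Rightarrow> 's) \<Rightarrow> bool" where
  "bad_level f \<epsilon> d \<omega> \<longleftrightarrow> (\<exists>p\<in>tree_level A Nb d. \<exists>a\<in>A. deviates (f d) (\<epsilon> d) \<omega> p a)"

lemma pred_deviates:
  assumes "f \<in> borel_measurable S" "p \<in> tree_level A Nb d" "a \<in> A" "d < k"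
  shows "Measurable.pred (trees k) (\<lambda>\<omega>. deviates f \<epsilon> \<omega> p a)"
proof -
  have p: "p \<in> tree_nodes A Nb k"
    using assms tree_level_subset_nodes[of d k] by auto
  have [measurable]: "(\<lambda>\<omega>. \<integral>b. f b \<partial>\<tau> (\<omega> p) a) \<in> borel_measurable (trees k)"
    by (rule measurable_compose[OF measurable_component_singleton[OF p]
          borel_measurable_kernel_integral[OF assms(1,3)]])
  have [measurable]: "(\<lambda>\<omega>. f (\<omega> (p @ [(a, i)]))) \<in> borel_measurable (trees k)" if "i < Nb" for i
  proof -
    have node: "p @ [(a, i)] \<in> tree_nodes A Nb k"
      using tree_level_child[OF assms(2,3) that] tree_level_subset_nodes[of "Suc d" k] assms(4) by auto
    show ?thesis
      by (rule measurable_compose[OF measurable_component_singleton[OF node] assms(1)])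
  qed
  show ?thesis
    unfolding deviates_def by measurable
qed

lemma pred_bad_level:
  assumes "\<And>d. f d \<in> borel_measurable S" "d < k"
  shows "Measurable.pred (trees k) (bad_level f \<epsilon> d)"
  unfolding bad_level_def[abs_def] using assms
  by (intro pred_intros_finite finite_tree_level finite_A pred_deviates)

lemma extend_old:
  "p \<in> tree_nodes A Nb k \<Longrightarrow> extend k \<omega> \<omega>' p = \<omega> p"
  by (simp add: merge_def)

lemma extend_new:
  "p \<in> tree_level A Nb (Suc k) \<Longrightarrow> extend k \<omega> \<omega>' p = \<omega>' p"
  by (auto simp: merge_def tree_level_def tree_nodes_def)

text \<open>A test at level \<open>d < k\<close> reads nodes of depth at most \<open>Suc d\<close>,
  hence at most \<open>k\<close>, and these keep their beliefs when the next level is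
  attached.\<close>

lemma bad_level_extend:
  assumes "d < k"
  shows "bad_level f \<epsilon> d (extend k \<omega> \<omega>') \<longleftrightarrow> bad_level f \<epsilon> d \<omega>"
proof -
  have "deviates (f d) (\<epsilon> d) (extend k \<omega> \<omega>') p a \<longleftrightarrow> deviates (f d) (\<epsilon> d) \<omega> p a"
    if "p \<in> tree_level A Nb d" "a \<in> A" for p a
  proof -
    have p: "p \<in> tree_nodes A Nb k"
      using tree_level_subset_nodes[of d k] assms that(1) by auto
    have c: "p @ [(a, i)] \<in> tree_nodes A Nb k" if "i < Nb" for i
      using subsetD[OF tree_level_subset_nodes[of "Suc d" k]] assms that
        tree_level_child[OF \<open>p \<in> tree_level A Nb d\<close> \<open>a \<in> A\<close> that] by simp
    show ?thesis
      unfolding deviates_def by (simp add: extend_old p c cong: sum.cong_simp)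
  qed
  then show ?thesis
    unfolding bad_level_def by blast
qed

lemma children_prob_space:
  assumes "\<omega> \<in> space (trees k)"
  shows "prob_space (children k \<omega>)"
    and "sets (children k \<omega>) = sets (\<Pi>\<^sub>M p\<in>tree_level A Nb (Suc k). S)"
    and "space (children k \<omega>) = space (\<Pi>\<^sub>M p\<in>tree_level A Nb (Suc k). S)"
  using measurable_space[OF measurable_children assms]
  by (auto simp: space_prob_algebra dest: sets_eq_imp_space_eq)

text \<open>Given \<open>\<omega>\<close>, the children of \<open>p\<close> under \<open>a\<close>
  are independent samples from one law. Taking the tolerance proportional to the width
  \<open>w\<close> cancels \<open>w\<close> in Hoeffding's exponent.\<close>

lemma emeasure_deviates_le:
  assumes \<omega>: "\<omega> \<in> space (trees k)" and p: "p \<in> tree_level A Nb k" and a: "a \<in> A"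
    and f: "f \<in> borel_measurable S" "\<And>b. b \<in> space S \<Longrightarrow> l \<le> f b \<and> f b \<le> l + w"
    and "0 \<le> w" "0 \<le> r"
  shows "emeasure (children k \<omega>) {\<omega>' \<in> space (children k \<omega>). deviates f (w * r) (extend k \<omega> \<omega>') p a}
    \<le> ennreal (2 * exp (- (2 * real Nb * r\<^sup>2)))"
proof -
  have node: "\<omega> q \<in> space S" if "q \<in> tree_level A Nb k" for q
    using \<omega> that tree_level_subset_nodes[of k k] by (auto simp: space_PiM)
  note ker = kernelD[OF node[OF p] a]
  have f': "f \<in> borel_measurable (\<tau> (\<omega> p) a)"
    using f(1) measurable_cong_sets[OF ker(2) refl] by blast
  have dev: "deviates f (w * r) (extend k \<omega> \<omega>') p a \<longleftrightarrow>
      w * r < \<bar>(\<Sum>i<Nb. f (\<omega>' (p @ [(a, i)]))) / real Nb - (\<integral>b. f b \<partial>\<tau> (\<omega> p) a)\<bar>" for \<omega>'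
    using p a tree_level_subset_nodes[of k k] unfolding deviates_def
    by (subst extend_old) (auto simp: extend_new tree_level_child)
  interpret C: prob_space "children k \<omega>"
    by (rule children_prob_space[OF \<omega>])
  show ?thesis
  proof (cases "w = 0")
    \<comment> \<open>Hoeffding's inequality needs an interval of positive width. At width 0 the
      function is constant and the sample mean equals the expectation exactly.\<close>
    case True
    interpret prob_space "\<tau> (\<omega> p) a"
      by (rule ker)
    have const: "f b = l" if "b \<in> space S" for b
      using f(2)[OF that] True by simp
    have "(\<integral>b. f b \<partial>\<tau> (\<omega> p) a) = (\<integral>b. l \<partial>\<tau> (\<omega> p) a)"
      using const ker(3) by (intro Bochner_Integration.integral_cong) auto
    then have int: "(\<integral>b. f b \<partial>\<tau> (\<omega> p) a) = l"
      by (simp add: prob_space)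
    have "\<not> deviates f (w * r) (extend k \<omega> \<omega>') p a" if "\<omega>' \<in> space (children k \<omega>)" for \<omega>'
    proof -
      have "\<omega>' (p @ [(a, i)]) \<in> space S" if "i < Nb" for i
        using \<open>\<omega>' \<in> _\<close> tree_level_child[OF p a that] unfolding children_prob_space(3)[OF \<omega>]
        by (auto simp: space_PiM)
      then have "(\<Sum>i<Nb. f (\<omega>' (p @ [(a, i)]))) = (\<Sum>i<Nb. l)"
        using const by (intro sum.cong) auto
      then show ?thesis
        unfolding dev int using True Nb_pos by simp
    qed
    then have "{\<omega>' \<in> space (children k \<omega>). deviates f (w * r) (extend k \<omega> \<omega>') p a} = {}"
      by blast
    then show ?thesis
      by (simp only: emeasure_empty) simp
  next
    case False
    \<comment> \<open>The non-strict event treated by Hoeffding's inequality contains the strict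
      one. The selected coordinates are the nodes \<open>p @ [(a, i)]\<close>, all with factor
      \<open>\<tau> (\<omega> p) a\<close>.\<close>
    let ?H = "{\<omega>' \<in> space (children k \<omega>).
      w * r \<le> \<bar>(\<Sum>i<Nb. f (\<omega>' (p @ [(a, i)]))) / real Nb - (\<integral>b. f b \<partial>\<tau> (\<omega> p) a)\<bar>}"
    have "measure (children k \<omega>) ?H \<le> 2 * exp (- (2 * real Nb * (w * r)\<^sup>2 / w\<^sup>2))"
    proof (rule Hoeffding_ineq_PiM_components)
      fix q assume "q \<in> tree_level A Nb (Suc k)"
      then show "prob_space (\<tau> (\<omega> (butlast q)) (fst (last q)))"
        using tree_level_Suc_parent[of q A Nb k] by (intro kernelD node)
    next
      show "l \<le> f b \<and> f b \<le> l + w" if "b \<in> space (\<tau> (\<omega> p) a)" for b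
        using that f(2) ker(3) by auto
    qed (use p a f' Nb_pos False assms in \<open>auto intro!: inj_onI tree_level_child\<close>)
    also have "2 * real Nb * (w * r)\<^sup>2 / w\<^sup>2 = 2 * real Nb * r\<^sup>2"
      using False by (simp add: power_mult_distrib)
    finally have le: "emeasure (children k \<omega>) ?H \<le> ennreal (2 * exp (- (2 * real Nb * r\<^sup>2)))"
      by (simp add: C.emeasure_eq_measure ennreal_leI)
    have "(\<lambda>\<omega>'. f (\<omega>' (p @ [(a, i)]))) \<in> borel_measurable (children k \<omega>)" if "i < Nb" for i
      using measurable_compose[OF measurable_component_singleton[OF tree_level_child[OF p a that],
            of "\<lambda>q. \<tau> (\<omega> (butlast q)) (fst (last q))"], of f borel] f' by simp
    then have "?H \<in> sets (children k \<omega>)"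
      by measurable
    then show ?thesis
      using le by (intro order_trans[OF emeasure_mono le]) (auto simp: dev)
  qed
qed

lemma root_in_tree_nodes: "[] \<in> tree_nodes A Nb k"
  using tree_level_subset_nodes[of 0 k] root_in_tree_level[of A Nb] by auto

text \<open>The singleton of the root belief need not be measurable, so the condition that the root carries
  that belief is expressed through a measurable function \<open>h\<close>.\<close>

lemma sets_bad:
  assumes h: "h \<in> borel_measurable S" and f: "\<And>d. f d \<in> borel_measurable S"
  shows "{\<omega> \<in> space (trees k). h (\<omega> []) \<noteq> (v :: real) \<or> (\<exists>d<k. bad_level f \<epsilon> d \<omega>)} \<in> sets (trees k)"
proof -
  have "(\<lambda>\<omega>. h (\<omega> [])) \<in> borel_measurable (trees k)"
    by (rule measurable_compose[OF measurable_component_singleton[OF root_in_tree_nodes] h])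
  then have "Measurable.pred (trees k) (\<lambda>\<omega>. h (\<omega> []) \<noteq> v)"
    by measurable
  moreover have "Measurable.pred (trees k) (\<lambda>\<omega>. \<exists>d\<in>{..<k}. bad_level f \<epsilon> d \<omega>)"
    using pred_bad_level[OF f] by (intro pred_intros_finite) simp_all
  ultimately have "Measurable.pred (trees k) (\<lambda>\<omega>. h (\<omega> []) \<noteq> v \<or> (\<exists>d\<in>{..<k}. bad_level f \<epsilon> d \<omega>))"
    by (rule pred_intros_logic)
  then show ?thesis
    unfolding pred_def bex_simps lessThan_iff Bex_def .
qed

text \<open>Induction on the depth, conditioning on the tree built so far: level \<open>k\<close>
  adds at most one Hoeffding bound for each of its node-action pairs. The geometric sum counts the
  nodes of depth less than \<open>k\<close>, and the factor \<open>card A\<close> their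
  actions.\<close>

lemma emeasure_bad_le:
  assumes b: "b \<in> space S" and h: "h \<in> borel_measurable S"
    and f: "\<And>d. f d \<in> borel_measurable S"
      "\<And>d. \<exists>l. \<forall>b\<in>space S. l \<le> f d b \<and> f d b \<le> l + w d"
    and w: "\<And>d. 0 \<le> w d" and r: "0 \<le> r"
  shows "emeasure (sample_tree S A \<tau> Nb b k)
      {\<omega> \<in> space (trees k). h (\<omega> []) \<noteq> (h b :: real) \<or> (\<exists>d<k. bad_level f (\<lambda>d. w d * r) d \<omega>)}
    \<le> ennreal ((\<Sum>d<k. (real (card A) * real Nb) ^ d) * (real (card A) * (2 * exp (- (2 * real Nb * r\<^sup>2)))))"
proof (induction k)
  case 0
  \<comment> \<open>At depth 0 the law is a point mass with root belief \<open>b\<close>, and no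
    level has been tested yet.\<close>
  show ?case
    using sets_bad[OF h f(1), of 0] root_in_tree_nodes[of 0] by simp
next
  case (Suc k)
  let ?q = "2 * exp (- (2 * real Nb * r\<^sup>2))"
  let ?B = "\<lambda>k. {\<omega> \<in> space (trees k). h (\<omega> []) \<noteq> h b \<or> (\<exists>d<k. bad_level f (\<lambda>d. w d * r) d \<omega>)}"
  let ?K = "\<lambda>\<omega>. distr (children k \<omega>) (trees (Suc k)) (extend k \<omega>)"
  let ?c = "(real (card A) * real Nb) ^ k * (real (card A) * ?q)"
  have fin: "finite (tree_level A Nb k \<times> A)"
    by (simp add: finite_tree_level finite_A)
  have sets_B: "?B k \<in> sets (trees k)" for k
    by (rule sets_bad[OF h f(1)])
  \<comment> \<open>If the tree is already bad, the indicator alone bounds the conditional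
    probability; otherwise only the new level can fail, with conditional probability at most
    \<open>?c\<close>. Integrating this over \<open>\<omega>\<close> gives the induction
    step.\<close>
  have step: "emeasure (?K \<omega>) (?B (Suc k)) \<le> indicator (?B k) \<omega> + ennreal ?c"
    if \<omega>: "\<omega> \<in> space (trees k)" for \<omega>
  proof -
    interpret K: prob_space "?K \<omega>"
      using measurable_space[OF measurable_step \<omega>] by (simp add: space_prob_algebra)
    show ?thesis
    proof (cases "\<omega> \<in> ?B k")
      case True
      then show ?thesis
        using K.emeasure_le_1[of "?B (Suc k)"] by (simp add: add_increasing2)
    next
      case False
      let ?D = "\<lambda>(p, a). {\<omega>' \<in> space (children k \<omega>). deviates (f k) (w k * r) (extend k \<omega> \<omega>') p a}"
      have ext: "extend k \<omega> \<in> children k \<omega> \<rightarrow>\<^sub>M trees (Suc k)"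
        using measurable_compose[OF measurable_Pair1'[OF \<omega>] measurable_extend]
        by (simp add: measurable_cong_sets[OF children_prob_space(2)[OF \<omega>] refl])
      have D_sets: "?D x \<in> sets (children k \<omega>)" if x_in: "x \<in> tree_level A Nb k \<times> A" for x
      proof -
        obtain p a where x: "x = (p, a)" "p \<in> tree_level A Nb k" "a \<in> A"
          using x_in by blast
        have "Measurable.pred (children k \<omega>) (\<lambda>\<omega>'. deviates (f k) (w k * r) (extend k \<omega> \<omega>') p a)"
          by (rule measurable_compose[OF ext pred_deviates[OF f(1) x(2,3) lessI]])
        then show ?thesis
          unfolding x(1) pred_def by simp
      qed
      have "emeasure (?K \<omega>) (?B (Suc k))
          = emeasure (children k \<omega>) (extend k \<omega> -` ?B (Suc k) \<inter> space (children k \<omega>))"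
        by (rule emeasure_distr[OF ext sets_B])
      also have "\<dots> \<le> emeasure (children k \<omega>) (\<Union>x\<in>tree_level A Nb k \<times> A. ?D x)"
      proof (rule emeasure_mono)
        show "(\<Union>x\<in>tree_level A Nb k \<times> A. ?D x) \<in> sets (children k \<omega>)"
          using D_sets fin by blast
        show "extend k \<omega> -` ?B (Suc k) \<inter> space (children k \<omega>) \<subseteq> (\<Union>x\<in>tree_level A Nb k \<times> A. ?D x)"
        proof
          fix \<omega>' assume "\<omega>' \<in> extend k \<omega> -` ?B (Suc k) \<inter> space (children k \<omega>)"
          \<comment> \<open>The extension changes neither the root nor the outcome at levels below
            \<open>k\<close>, so a failure must occur at level \<open>k\<close>.\<close>
          then have "\<omega>' \<in> space (children k \<omega>)" and "bad_level f (\<lambda>d. w d * r) k (extend k \<omega> \<omega>')"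
            using False \<omega> bad_level_extend[of _ k] extend_old[OF root_in_tree_nodes] by (auto simp: less_Suc_eq)
          then show "\<omega>' \<in> (\<Union>x\<in>tree_level A Nb k \<times> A. ?D x)"
            unfolding bad_level_def by auto
        qed
      qed
      also have "\<dots> \<le> (\<Sum>x\<in>tree_level A Nb k \<times> A. emeasure (children k \<omega>) (?D x))"
        using D_sets fin by (intro emeasure_subadditive_finite) blast+
      also have "\<dots> \<le> (\<Sum>x\<in>tree_level A Nb k \<times> A. ennreal ?q)"
      proof (rule sum_mono)
        fix x assume x: "x \<in> tree_level A Nb k \<times> A"
        obtain l where "\<And>b. b \<in> space S \<Longrightarrow> l \<le> f k b \<and> f k b \<le> l + w k"
          using f(2)[of k] by blast
        then show "emeasure (children k \<omega>) (?D x) \<le> ennreal ?q"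
          using emeasure_deviates_le[OF \<omega> _ _ f(1) _ w r, of "fst x" "snd x" l] x by auto
      qed
      also have "\<dots> = ennreal (real (card (tree_level A Nb k \<times> A)) * ?q)"
        by (simp add: ennreal_of_nat_eq_real_of_nat flip: ennreal_mult)
      also have "real (card (tree_level A Nb k \<times> A)) * ?q = ?c"
        by (simp add: card_cartesian_product card_tree_level finite_A)
      finally show ?thesis
        using False by simp
    qed
  qed
  interpret P: prob_space "sample_tree S A \<tau> Nb b k"
    by (rule prob_space_sample_tree[OF b])
  have "emeasure (sample_tree S A \<tau> Nb b (Suc k)) (?B (Suc k))
      = (\<integral>\<^sup>+\<omega>. emeasure (?K \<omega>) (?B (Suc k)) \<partial>sample_tree S A \<tau> Nb b k)"
    unfolding sample_tree.simps
    by (rule emeasure_bind_prob_algebra[OF sample_tree_in_prob_algebra[OF b] measurable_step sets_B])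
  also have "\<dots> \<le> (\<integral>\<^sup>+\<omega>. indicator (?B k) \<omega> + ennreal ?c \<partial>sample_tree S A \<tau> Nb b k)"
    by (rule nn_integral_mono, rule step) (simp only: space_sample_tree[OF b])
  also have "\<dots> = emeasure (sample_tree S A \<tau> Nb b k) (?B k) + ennreal ?c"
  proof -
    have "?B k \<in> P.events"
      unfolding sets_sample_tree[OF b] by (rule sets_B)
    then have "(\<integral>\<^sup>+\<omega>. indicator (?B k) \<omega> + ennreal ?c \<partial>sample_tree S A \<tau> Nb b k)
        = (\<integral>\<^sup>+\<omega>. indicator (?B k) \<omega> \<partial>sample_tree S A \<tau> Nb b k)
          + (\<integral>\<^sup>+\<omega>. ennreal ?c \<partial>sample_tree S A \<tau> Nb b k)"
      by (intro nn_integral_add borel_measurable_indicator borel_measurable_const)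
    also have "\<dots> = emeasure (sample_tree S A \<tau> Nb b k) (?B k) + ennreal ?c"
      using \<open>?B k \<in> P.events\<close> by (simp only: nn_integral_indicator nn_integral_const P.emeasure_space_1 mult_1_right)
    finally show ?thesis .
  qed
  also have "\<dots> \<le> ennreal ((\<Sum>d<k. (real (card A) * real Nb) ^ d) * (real (card A) * ?q)) + ennreal ?c"
    by (intro add_right_mono Suc)
  also have "\<dots> = ennreal ((\<Sum>d<Suc k. (real (card A) * real Nb) ^ d) * (real (card A) * ?q))"
    unfolding sum.lessThan_Suc distrib_right
    by (rule ennreal_plus[symmetric];
        intro mult_nonneg_nonneg sum_nonneg zero_le_power of_nat_0_le_iff exp_ge_zero zero_le_numeral)
  finally show ?case .
qed

section \<open>Accumulation of errors along the levels\<close>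

lemma sum_reversed_naturals: "(\<Sum>d<n. real (n - d)) = real n * (real n + 1) / 2"
proof (induction n)
  case (Suc n)
  then show ?case
    by (simp add: sum.lessThan_Suc_shift field_simps del: sum.lessThan_Suc)
qed simp

text \<open>A deterministic statement about one tree, by induction from the deepest level up to the
  root: each level adds its own sampling tolerance to the error inherited from the children.\<close>

lemma V_hat_error:
  assumes "t + n = T" "d \<le> n" "p \<in> tree_level A Nb d"
    and good: "\<And>j. j < n \<Longrightarrow> \<not> bad_level (\<lambda>j. V_opt A \<tau> \<rho> \<gamma> T (Suc (t + j))) \<epsilon> j \<omega>"
  shows "\<bar>V_opt A \<tau> \<rho> \<gamma> T (t + d) (\<omega> p) - V_hat A \<rho> \<gamma> Nb T \<omega> (t + d) p\<bar> \<le> (\<Sum>j=d..<n. \<epsilon> j)"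
  using assms(2,3)
proof (induction d arbitrary: p rule: inc_induct)
  \<comment> \<open>Depth \<open>n\<close> is time \<open>T\<close>: both continuation values are 0,
    so optimum and estimate are the same minimum of costs. Hence only the levels before
    \<open>n\<close> contribute.\<close>
  case base
  have "V_opt A \<tau> \<rho> \<gamma> T (Suc T) = (\<lambda>_. 0)"
    by (rule ext, subst V_opt.simps) simp
  moreover have "V_hat A \<rho> \<gamma> Nb T \<omega> (Suc T) q = 0" for q
    by (subst V_hat.simps) simp
  ultimately have "V_opt A \<tau> \<rho> \<gamma> T T (\<omega> p) = V_hat A \<rho> \<gamma> Nb T \<omega> T p"
    by (subst V_opt.simps, subst V_hat.simps) (simp add: Q_opt.simps Q_hat.simps)
  then show ?case
    using assms(1) by simp
next
  case (step d)
  let ?V = "V_opt A \<tau> \<rho> \<gamma> T (Suc (t + d))" and ?W = "V_hat A \<rho> \<gamma> Nb T \<omega> (Suc (t + d))"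
  have "\<bar>Q_opt A \<tau> \<rho> \<gamma> T (t + d) (\<omega> p) a - Q_hat A \<rho> \<gamma> Nb T \<omega> (t + d) p a\<bar> \<le> (\<Sum>j=d..<n. \<epsilon> j)"
    if a: "a \<in> A" for a
  proof -
    let ?c = "\<lambda>i. p @ [(a, i)]"
    let ?E = "\<integral>b. ?V b \<partial>\<tau> (\<omega> p) a"
    \<comment> \<open>The mean of the optimal values at the sampled children is the intermediate
      term: its distance to \<open>?E\<close> is the sampling deviation at this node, and its
      distance to \<open>?mW\<close> is at most the average error of the children.\<close>
    let ?mV = "(\<Sum>i<Nb. ?V (\<omega> (?c i))) / real Nb" and ?mW = "(\<Sum>i<Nb. ?W (?c i)) / real Nb"
    have "\<bar>?mV - ?E\<bar> \<le> \<epsilon> d"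
      using good[OF step(2)] step.prems a unfolding bad_level_def deviates_def by (auto simp: not_less)
    moreover have "\<bar>?mV - ?mW\<bar> \<le> (\<Sum>j=Suc d..<n. \<epsilon> j)"
    proof -
      have "\<bar>\<Sum>i<Nb. ?V (\<omega> (?c i)) - ?W (?c i)\<bar> \<le> (\<Sum>i<Nb. \<Sum>j=Suc d..<n. \<epsilon> j)"
        using step.IH tree_level_child[OF step.prems a]
        by (intro order_trans[OF sum_abs sum_mono]) simp
      then have "\<bar>\<Sum>i<Nb. ?V (\<omega> (?c i)) - ?W (?c i)\<bar> / real Nb \<le> (\<Sum>j=Suc d..<n. \<epsilon> j)"
        using Nb_pos by (simp add: divide_simps mult.commute)
      then show ?thesis
        by (simp add: sum_subtractf flip: diff_divide_distrib)
    qed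
    ultimately have "\<bar>?E - ?mW\<bar> \<le> \<epsilon> d + (\<Sum>j=Suc d..<n. \<epsilon> j)"
      by linarith
    moreover have "\<gamma> * \<bar>?E - ?mW\<bar> \<le> \<bar>?E - ?mW\<bar>"
      using \<gamma>_pos \<gamma>_le_1 by (intro mult_left_le_one_le) auto
    moreover have "Q_opt A \<tau> \<rho> \<gamma> T (t + d) (\<omega> p) a - Q_hat A \<rho> \<gamma> Nb T \<omega> (t + d) p a = \<gamma> * (?E - ?mW)"
      by (simp add: Q_opt.simps Q_hat.simps algebra_simps)
    ultimately show ?thesis
      using \<gamma>_pos step(2) by (simp add: abs_mult sum.atLeast_Suc_lessThan)
  qed
  then show ?case
    using step(2) assms(1) finite_A A_nonempty
    by (subst V_opt.simps, subst V_hat.simps) (auto intro!: abs_Min_diff_le)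
qed

text \<open>The deviation parameter \<open>r\<close> is left free. The estimate can miss the bound
  only on a bad tree, so the complement of the success event lies in the event bounded by
  \<open>emeasure_bad_le\<close>.\<close>

theorem sparse_sampling_error:
  assumes b: "b \<in> space S" and t: "t \<le> T" and r: "0 \<le> r"
  defines "n \<equiv> T - t"
  shows "\<P>(\<omega> in sample_tree S A \<tau> Nb b n. \<bar>V_opt A \<tau> \<rho> \<gamma> T t b - V_hat A \<rho> \<gamma> Nb T \<omega> t []\<bar>
        \<le> (hi - lo) * (real n * (real n + 1) / 2) * r)
    \<ge> 1 - (\<Sum>d<n. (real (card A) * real Nb) ^ d) * (real (card A) * (2 * exp (- (2 * real Nb * r\<^sup>2))))"
    (is "_ \<ge> 1 - ?q")
proof -
  let ?P = "sample_tree S A \<tau> Nb b n"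
  \<comment> \<open>Taking \<open>h\<close> to be the optimal value itself suffices: the
    deterministic error bound speaks of the root only through \<open>?h (\<omega> [])\<close>. At
    depth \<open>d\<close> the values \<open>?f d\<close> belong to time \<open>t + d + 1\<close>,
    which leaves \<open>n - d\<close> costs and thus the width \<open>?w d\<close>.\<close>
  let ?f = "\<lambda>d. V_opt A \<tau> \<rho> \<gamma> T (Suc (t + d))" and ?h = "V_opt A \<tau> \<rho> \<gamma> T t"
  let ?w = "\<lambda>d. (hi - lo) * real (n - d)"
  let ?B = "{\<omega> \<in> space (trees n). ?h (\<omega> []) \<noteq> ?h b \<or> (\<exists>d<n. bad_level ?f (\<lambda>d. ?w d * r) d \<omega>)}"
  let ?G = "{\<omega> \<in> space ?P. \<bar>?h b - V_hat A \<rho> \<gamma> Nb T \<omega> t []\<bar>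
    \<le> (hi - lo) * (real n * (real n + 1) / 2) * r}"
  interpret P: prob_space ?P
    by (rule prob_space_sample_tree[OF b])
  have range: "\<exists>l. \<forall>b\<in>space S. l \<le> ?f d b \<and> ?f d b \<le> l + ?w d" for d
    using V_opt_range[of T "Suc (t + d)"] t by (simp add: n_def)
  have w: "0 \<le> ?w d" for d
    using lo_le_hi by simp
  have "emeasure ?P ?B \<le> ennreal ?q"
    by (rule emeasure_bad_le[OF b borel_measurable_V_opt borel_measurable_V_opt range w r])
  moreover have "0 \<le> ?q"
    by (intro mult_nonneg_nonneg sum_nonneg zero_le_power of_nat_0_le_iff exp_ge_zero zero_le_numeral)
  ultimately have B_le: "measure ?P ?B \<le> ?q"
    unfolding measure_def by (simp only: enn2real_leI)
  have "(\<lambda>\<omega>. V_hat A \<rho> \<gamma> Nb T \<omega> t []) \<in> borel_measurable ?P"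
    unfolding measurable_cong_sets[OF sets_sample_tree[OF b] refl]
    by (rule borel_measurable_V_hat) (simp_all add: n_def)
  note [measurable] = this
  have G: "?G \<in> P.events"
    by measurable
  \<comment> \<open>The tolerances are proportional to \<open>n, n - 1, \<dots>, 1\<close>; their
    sum is the triangular number in the bound.\<close>
  have eps: "(\<Sum>d=0..<n. ?w d * r) = (hi - lo) * (real n * (real n + 1) / 2) * r"
  proof -
    have "(\<Sum>d<n. real (n - d)) = real n * (real n + 1) / 2"
      by (rule sum_reversed_naturals)
    then show ?thesis
      by (simp only: lessThan_atLeast0 flip: sum_distrib_left sum_distrib_right)
  qed
  have "space ?P - ?G \<subseteq> ?B"
  proof
    fix \<omega> assume \<omega>: "\<omega> \<in> space ?P - ?G"
    show "\<omega> \<in> ?B"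
    proof (rule ccontr)
      assume "\<omega> \<notin> ?B"
      with \<omega> have "?h (\<omega> []) = ?h b" and "\<And>d. d < n \<Longrightarrow> \<not> bad_level ?f (\<lambda>d. ?w d * r) d \<omega>"
        using space_sample_tree[OF b] by auto
      then show False
        using V_hat_error[of t n T 0 "[]" "\<lambda>d. ?w d * r" \<omega>] \<omega> t root_in_tree_level[of A Nb]
        unfolding eps by (simp add: n_def)
    qed
  qed
  moreover have "?B \<in> P.events"
    unfolding sets_sample_tree[OF b]
    by (rule sets_bad[OF borel_measurable_V_opt borel_measurable_V_opt])
  ultimately have "measure ?P (space ?P - ?G) \<le> measure ?P ?B"
    by (intro P.finite_measure_mono) auto
  then show ?thesis
    using P.prob_compl[OF G] B_le by simp
qed

text \<open>For \<open>n > 0\<close> the parameter \<open>r\<close> is the solution of the equation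
  that sets the union bound equal to \<open>\<delta>\<close>.\<close>

theorem sparse_sampling_confidence:
  assumes b: "b \<in> space S" and t: "t \<le> T" and \<delta>: "0 < \<delta>" "\<delta> < 1" and Nb: "1 < Nb"
  defines "n \<equiv> T - t"
  shows "\<P>(\<omega> in sample_tree S A \<tau> Nb b n. \<bar>V_opt A \<tau> \<rho> \<gamma> T t b - V_hat A \<rho> \<gamma> Nb T \<omega> t []\<bar>
        \<le> (hi - lo) * (real n * (real n + 1) / 2)
          * sqrt (ln (2 * real (card A) * ((real (card A) * real Nb) ^ n - 1)
              / (\<delta> * (real (card A) * real Nb - 1))) / (2 * real Nb)))
    \<ge> 1 - \<delta>"
proof (cases "n = 0")
  \<comment> \<open>At the horizon there is no sampling error: the empty geometric sum makes the
    failure bound 0, and the factor \<open>n\<close> makes the tolerance 0 whatever value the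
    logarithm takes.\<close>
  case True
  then show ?thesis
    using sparse_sampling_error[OF b t, of 0] \<delta> unfolding n_def by simp
next
  case False
  \<comment> \<open>\<open>K * G\<close> is the number of node-action pairs of depth less than
    \<open>n\<close>, and \<open>L\<close> is chosen so that
    \<open>2 * (K * G) * exp (- L) = \<delta>\<close>.\<close>
  define K where "K = real (card A)"
  define G where "G = (\<Sum>d<n. (K * real Nb) ^ d)"
  define L where "L = ln (2 * (K * G) / \<delta>)"
  have K: "1 \<le> K"
    using finite_A A_nonempty card_gt_0_iff[of A] unfolding K_def by linarith
  \<comment> \<open>With \<open>Nb > 1\<close> the ratio exceeds 1 even for a single action, so the
    geometric sum has its closed form.\<close>
  have q: "1 < K * real Nb"
    using mult_mono[of 1 K 2 "real Nb"] K Nb by simp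
  have "(K * real Nb) ^ 0 \<le> G"
    unfolding G_def using False K by (intro member_le_sum) auto
  then have G: "1 \<le> G"
    by simp
  have KG: "1 \<le> K * G"
    using mult_mono[of 1 K 1 G] K G by simp
  \<comment> \<open>As \<open>\<delta> < 1 \<le> K * G\<close>, the logarithm is nonnegative; hence
    squaring the square root gives back \<open>L / (2 * real Nb)\<close>.\<close>
  then have ratio: "1 \<le> 2 * (K * G) / \<delta>"
    using \<delta> by (simp add: le_divide_eq)
  then have L: "0 \<le> L"
    by (simp add: L_def)
  have G_eq: "G = ((K * real Nb) ^ n - 1) / (K * real Nb - 1)"
    unfolding G_def using q by (intro geometric_sum) simp
  have L_eq: "ln (2 * K * ((K * real Nb) ^ n - 1) / (\<delta> * (K * real Nb - 1))) = L"
    unfolding L_def G_eq by (simp add: ac_simps)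
  have exp_L: "exp (- L) = \<delta> / (2 * (K * G))"
    using ratio \<delta> KG by (simp add: L_def exp_minus exp_ln)
  have "2 * real Nb * (sqrt (L / (2 * real Nb)))\<^sup>2 = L"
    using L Nb by simp
  then have "G * (K * (2 * exp (- (2 * real Nb * (sqrt (L / (2 * real Nb)))\<^sup>2)))) = \<delta>"
    using KG by (simp only: exp_L) (auto simp: field_simps)
  then show ?thesis
    using sparse_sampling_error[OF b t, of "sqrt (L / (2 * real Nb))"] L
    unfolding n_def[symmetric] K_def[symmetric] G_def[symmetric] L_eq by simp
qed

end

section \<open>The particle belief MDP with CVaR costs\<close>

theorem theorem4p2:
  fixes X :: "'x measure"
    and A :: "'a set"
    and c :: "'x \<Rightarrow> 'a \<Rightarrow> real"
    and cmin cmax \<alpha> \<gamma> \<delta> :: real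
    and Np Nb T t :: nat
    and \<tau> :: "'x belief \<Rightarrow> 'a \<Rightarrow> 'x belief measure"
    and b :: "'x belief"
  assumes "finite A" and "A \<noteq> {}"
    and "\<And>a. a \<in> A \<Longrightarrow> (\<lambda>x. c x a) \<in> borel_measurable X"
    and "\<And>x a. x \<in> space X \<Longrightarrow> a \<in> A \<Longrightarrow> cmin \<le> c x a \<and> c x a \<le> cmax"
    and "\<And>a. a \<in> A \<Longrightarrow>
           (\<lambda>b. \<tau> b a) \<in> belief_space X Np \<rightarrow>\<^sub>M prob_algebra (belief_space X Np)"
    and "0 < \<alpha>" and "\<alpha> \<le> 1"
    and "0 < \<gamma>" and "\<gamma> \<le> 1"
    and "t \<le> T"
    and "b \<in> space (belief_space X Np)"
    and "0 < \<delta>" and "\<delta> < 1"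
    and "1 < Nb"
  shows "\<P>(\<omega> in sample_tree (belief_space X Np) A \<tau> Nb b (T - t).
            \<bar>V_opt A \<tau> (belief_cost Np c \<alpha>) \<gamma> T t b
               - V_hat A (belief_cost Np c \<alpha>) \<gamma> Nb T \<omega> t []\<bar>
            \<le> (if t = T then 0
               else (cmax - cmin) * (real (T - t) * (real (T - t) + 1) / 2)
                 * sqrt (ln (2 * real (card A) * ((real (card A) * real Nb) ^ (T - t) - 1)
                             / (\<delta> * (real (card A) * real Nb - 1)))
                         / (2 * real Nb)))) \<ge> 1 - \<delta>"
proof -
  have cost: "cmin \<le> belief_cost Np c \<alpha> b a \<and> belief_cost Np c \<alpha> b a \<le> cmax"
    if "b \<in> space (belief_space X Np)" "a \<in> A" for b a
    using belief_cost_bounds[OF assms(6,7) that(1), of cmin c a cmax] assms(4) that(2) by blast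
  \<comment> \<open>The cost of the given belief \<open>b\<close> under some action lies between the
    two bounds, which orders them.\<close>
  have le: "cmin \<le> cmax"
    using assms(2) cost[OF assms(11)] by force
  interpret sampled_mdp "belief_space X Np" A \<tau> "belief_cost Np c \<alpha>" \<gamma> cmin cmax Nb
  proof
    show "(\<lambda>b. belief_cost Np c \<alpha> b a) \<in> borel_measurable (belief_space X Np)" if "a \<in> A" for a
      using assms(4) that by (intro borel_measurable_belief_cost[where c=c and a=a and l=cmin] assms) auto
  qed (use assms cost le in auto)
  \<comment> \<open>At \<open>t = T\<close> the factor \<open>T - t\<close> already makes the
    general expression 0, so both branches agree.\<close>
  have *: "(if t = T then 0 else (cmax - cmin) * (real (T - t) * (real (T - t) + 1) / 2) * s)
      = (cmax - cmin) * (real (T - t) * (real (T - t) + 1) / 2) * s" for s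
    by simp
  show ?thesis
    unfolding * by (rule sparse_sampling_confidence[OF assms(11,10,12,13,14)])
qed

end
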